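(* (i) For $G = C_5$, with $n = m = 5$, one has $\chi(G) = \left\lceil \frac{m}{2\sqrt{n}} \right\rceil + 1$. (ii) Let $G_{11}$ be the Grötzsch graph. It has $n = 11$ vertices and $m = 20$ edges, and $\chi(G_{11}) = 4 = \left\lceil \frac{20}{\sqrt{60.5}} \right\rceil + 1$, so that $\chi(G_{11}) = \left\lceil \frac{m}{\sqrt{5.5\,n}} \right\rceil + 1$. Moreover, for every odd integer $\ell$ with $7 \leq \ell \leq 21$, the cycle $G = C_\ell$, with $n = m = \ell$, satisfies $\chi(G) = \left\lceil \frac{m}{\sqrt{5.5\,n}} \right\rceil + 1$.
   Context: All graphs are finite and simple. $\chi(G)$ denotes the (vertex) chromatic number of $G$; $n$ and $m$ denote the numbers of vertices and edges of the graph in question. $C_\ell$ denotes the cycle of length $\ell$. The Grötzsch graph $G_{11}$ has the $11$ vertices $u_1,\dots,u_5,v_1,\dots,v_5,w$, and its edges are, with indices taken modulo $5$: $u_iu_{i+1}$ for $1\le i\le 5$; $v_iu_{i-1}$ and $v_iu_{i+1}$ for $1\le i\le 5$; and $wv_i$ for $1\le i\le 5$. *)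

theory Defs
  imports Complex_Main
begin

text \<open>An undirected graph: each edge is the unordered pair of its two ends, so that
  \<open>card (uedges G)\<close> counts every edge once.\<close>

record 'a ugraph =
  uverts :: "'a set"
  uedges :: "'a set set"

definition simple_graph :: "'a ugraph \<Rightarrow> bool" where
  "simple_graph G \<longleftrightarrow>
     finite (uverts G) \<and> (\<forall>e\<in>uedges G. e \<subseteq> uverts G \<and> card e = 2)"

definition proper_colouring :: "'a ugraph \<Rightarrow> nat \<Rightarrow> ('a \<Rightarrow> nat) \<Rightarrow> bool" where
  "proper_colouring G k c \<longleftrightarrow>
     (\<forall>x\<in>uverts G. c x < k) \<and> (\<forall>x y. {x, y} \<in> uedges G \<longrightarrow> c x \<noteq> c y)"

text \<open>For a finite simple graph the set of admissible \<open>k\<close> is nonempty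
  (see \<open>simple_graph_colourable\<close> below), so the \<open>LEAST\<close> is attained.\<close>

definition chromatic_number :: "'a ugraph \<Rightarrow> nat" where
  "chromatic_number G = (LEAST k. \<exists>c. proper_colouring G k c)"

lemma simple_graph_colourable:
  assumes "simple_graph G"
  shows "\<exists>c. proper_colouring G (card (uverts G)) c"
proof -
  obtain c where c: "bij_betw c (uverts G) {0..<card (uverts G)}"
    using assms ex_bij_betw_finite_nat unfolding simple_graph_def by blast
  have "c x \<noteq> c y" if e: "{x, y} \<in> uedges G" for x y
  proof -
    have "x \<in> uverts G" "y \<in> uverts G" "card {x, y} = 2"
      using assms e unfolding simple_graph_def by auto
    moreover from this have "x \<noteq> y" by auto
    ultimately show ?thesis
      using c by (auto simp: bij_betw_def inj_on_def)
  qed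
  moreover have "\<forall>x\<in>uverts G. c x < card (uverts G)"
    using c by (auto simp: bij_betw_def)
  ultimately show ?thesis
    unfolding proper_colouring_def by blast
qed

text \<open>The cycle of length \<open>l\<close>, meaningful for \<open>l \<ge> 3\<close>.\<close>

definition cycle_graph :: "nat \<Rightarrow> nat ugraph" where
  "cycle_graph l =
     \<lparr>uverts = {..<l}, uedges = {{i, (i + 1) mod l} | i. i < l}\<rparr>"

lemma simple_graph_cycle_graph:
  assumes "3 \<le> l"
  shows "simple_graph (cycle_graph l)"
proof -
  have "i \<noteq> Suc i mod l" if "i < l" for i
    using assms that by (cases "Suc i = l") auto
  then show ?thesis
    using assms by (auto simp: simple_graph_def cycle_graph_def)
qed

text \<open>The indices modulo 5 are represented by the residues \<open>0, \<dots>, 4\<close>; they are integers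
  so that \<open>i - 1\<close> is not truncated.\<close>

datatype groetzsch_vertex = U int | V int | W

definition groetzsch_graph :: "groetzsch_vertex ugraph" where
  "groetzsch_graph =
     \<lparr>uverts = U ` {0..<5} \<union> V ` {0..<5} \<union> {W},
      uedges = {{U i, U ((i + 1) mod 5)} | i. i \<in> {0..<5}}
             \<union> {{V i, U ((i - 1) mod 5)} | i. i \<in> {0..<5}}
             \<union> {{V i, U ((i + 1) mod 5)} | i. i \<in> {0..<5}}
             \<union> {{W, V i} | i. i \<in> {0..<5}}\<rparr>"

lemma simple_graph_groetzsch_graph: "simple_graph groetzsch_graph"
proof -
  have "i \<noteq> (i + 1) mod 5" for i :: int
    by presburger
  then show ?thesis
    by (auto simp: simple_graph_def groetzsch_graph_def)
qed

end

theory Submission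
  imports Defs
begin

text \<open>
  Both parts compare a small chromatic number with an explicit ceiling.

  The chromatic numbers rest on one parity fact (\<open>no_alternation_on_odd_cycle\<close>): along a closed
  walk of odd length two values cannot alternate. For an odd cycle this excludes two colours, and
  colouring the vertices by parity, with a third colour at the last vertex, shows that three
  suffice.

  The Groetzsch graph is the Mycielski graph of \<open>C\<^sub>5\<close>, and the lower bound 4 is Mycielski's
  argument. In a colouring with three colours let \<open>a\<close> be the colour of \<open>W\<close>. No \<open>V i\<close> has colour
  \<open>a\<close>, and \<open>V i\<close> is adjacent to the same \<open>U j\<close> as \<open>U i\<close> is; so recolouring each \<open>U i\<close> of
  colour \<open>a\<close> with the colour of its twin \<open>V i\<close> gives a proper colouring of the 5-cycle of the
  \<open>U i\<close> that avoids \<open>a\<close>, hence one with two colours, contradicting the parity fact.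

  The ceilings are evaluated without approximating square roots: squaring turns
  \<open>k < a / sqrt b \<le> k + 1\<close> into two inequalities between rational numbers.
\<close>

section \<open>Chromatic numbers and ceilings\<close>

lemma chromatic_number_eqI:
  assumes "proper_colouring G k c"
    and "\<And>j d. proper_colouring G j d \<Longrightarrow> k \<le> j"
  shows "chromatic_number G = k"
  unfolding chromatic_number_def
  by (rule Least_equality) (use assms in blast)+

text \<open>Working with \<open>inj_on\<close> makes the condition on an edge symmetric in its ends, so each
  edge need be examined in one orientation only.\<close>

lemma proper_colouringI:
  assumes "simple_graph G"
    and "\<And>x. x \<in> uverts G \<Longrightarrow> c x < k"
    and inj: "\<And>e. e \<in> uedges G \<Longrightarrow> inj_on c e"
  shows "proper_colouring G k c"
proof -
  have "c x \<noteq> c y" if "{x, y} \<in> uedges G" for x y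
  proof -
    have "card {x, y} = 2"
      using assms(1) that by (simp add: simple_graph_def)
    then show ?thesis
      using inj[OF that] by (auto simp: inj_on_def)
  qed
  then show ?thesis
    using assms(2) by (simp add: proper_colouring_def)
qed

lemma ceiling_divide_sqrt:
  fixes a b :: real
  assumes "0 \<le> a" "0 < b" "(real k)\<^sup>2 * b < a\<^sup>2" "a\<^sup>2 \<le> (real k + 1)\<^sup>2 * b"
  shows "\<lceil>a / sqrt b\<rceil> = int k + 1"
proof (rule ceiling_unique)
  have "real k * sqrt b < a"
  proof (rule power2_less_imp_less)
    show "(real k * sqrt b)\<^sup>2 < a\<^sup>2"
      using assms by (simp add: power_mult_distrib)
  qed (use assms in simp)
  then show "of_int (int k + 1) - 1 < a / sqrt b"
    using assms by (simp add: pos_less_divide_eq)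
  have "a \<le> (real k + 1) * sqrt b"
  proof (rule power2_le_imp_le)
    show "a\<^sup>2 \<le> ((real k + 1) * sqrt b)\<^sup>2"
      using assms by (simp add: power_mult_distrib)
  qed (use assms in simp)
  then show "a / sqrt b \<le> of_int (int k + 1)"
    using assms by (simp add: pos_divide_le_eq)
qed

section \<open>Odd cycles\<close>

text \<open>If neighbours always differ, then the value at \<open>i\<close> is determined by the parity of \<open>i\<close>;
  for odd \<open>l\<close> the neighbours \<open>l - 1\<close> and \<open>0\<close> have the same parity.\<close>

lemma no_alternation_on_odd_cycle:
  fixes f :: "nat \<Rightarrow> 'a"
  assumes "odd l"
    and two: "\<And>i. i < l \<Longrightarrow> f i \<in> {p, q}"
    and step: "\<And>i. i < l \<Longrightarrow> f i \<noteq> f ((i + 1) mod l)"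
  shows False
proof -
  have parity: "f i = f 0 \<longleftrightarrow> even i" if "i < l" for i
    using that
  proof (induction i)
    case (Suc i)
    then have "f i \<noteq> f (Suc i)"
      using step[of i] by simp
    moreover have "f i \<in> {p, q}" "f (Suc i) \<in> {p, q}" "f 0 \<in> {p, q}"
      using Suc.prems two by auto
    ultimately have "f (Suc i) = f 0 \<longleftrightarrow> f i \<noteq> f 0"
      by (metis insert_iff empty_iff)
    moreover have "f i = f 0 \<longleftrightarrow> even i"
      using Suc by simp
    ultimately show ?case
      by simp
  qed simp
  have "0 < l"
    using \<open>odd l\<close> by (auto intro: Nat.gr0I)
  then show False
    using parity[of "l - 1"] step[of "l - 1"] \<open>odd l\<close> by simp
qed

lemma card_uverts_cycle_graph: "card (uverts (cycle_graph l)) = l"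
  by (simp add: cycle_graph_def)

text \<open>The ends of an edge determine its index only from length 3 on: in length 2 both indices
  give the same edge.\<close>

lemma card_uedges_cycle_graph:
  assumes "3 \<le> l"
  shows "card (uedges (cycle_graph l)) = l"
proof -
  have suc: "(i + 1) mod l = (if i = l - 1 then 0 else i + 1)" if "i < l" for i
    using that by auto
  have "inj_on (\<lambda>i. {i, (i + 1) mod l}) {..<l}"
  proof (rule inj_onI)
    fix i j
    assume "i \<in> {..<l}" "j \<in> {..<l}" "{i, (i + 1) mod l} = {j, (j + 1) mod l}"
    then show "i = j"
      using assms suc[of i] suc[of j] by (auto simp: doubleton_eq_iff split: if_splits)
  qed
  moreover have "uedges (cycle_graph l) = (\<lambda>i. {i, (i + 1) mod l}) ` {..<l}"
    by (auto simp: cycle_graph_def)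
  ultimately show ?thesis
    by (simp add: card_image)
qed

lemma chromatic_number_odd_cycle_graph:
  assumes "odd l" "3 \<le> l"
  shows "chromatic_number (cycle_graph l) = 3"
proof (rule chromatic_number_eqI)
  define c :: "nat \<Rightarrow> nat" where "c i = (if i = l - 1 then 2 else i mod 2)" for i
  have "c i \<noteq> c ((i + 1) mod l)" if "i < l" for i
  proof (cases "i = l - 1")
    case True
    then have "(i + 1) mod l = 0"
      using assms by simp
    then show ?thesis
      using True assms by (simp add: c_def)
  next
    case False
    then have "(i + 1) mod l = i + 1"
      using that by simp
    moreover have "i mod 2 \<noteq> (i + 1) mod 2" "i mod 2 \<noteq> 2"
      by presburger+
    ultimately show ?thesis
      using False by (simp add: c_def)
  qed
  then have inj: "inj_on c {i, (i + 1) mod l}" if "i < l" for i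
    using that by (simp add: inj_on_def eq_commute)
  show "proper_colouring (cycle_graph l) 3 c"
  proof (rule proper_colouringI)
    have "i mod 2 < 2" for i :: nat
      by simp
    then show "c i < 3" for i
      unfolding c_def by (simp add: less_SucI numeral_3_eq_3 numeral_2_eq_2)
    show "inj_on c e" if "e \<in> uedges (cycle_graph l)" for e
      using that inj unfolding cycle_graph_def ugraph.simps by blast
  qed (use assms simple_graph_cycle_graph in blast)
next
  fix j d
  assume d: "proper_colouring (cycle_graph l) j d"
  show "3 \<le> j"
  proof (rule ccontr)
    assume "\<not> 3 \<le> j"
    then have "d i \<in> {0, 1}" if "i < l" for i
      using d that by (force simp: proper_colouring_def cycle_graph_def)
    moreover have "d i \<noteq> d ((i + 1) mod l)" if "i < l" for i
      using d that unfolding proper_colouring_def cycle_graph_def by auto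
    ultimately show False
      using no_alternation_on_odd_cycle[OF \<open>odd l\<close>, of d 0 1] by blast
  qed
qed

section \<open>The Groetzsch graph\<close>

lemma residues_mod_5: "{0..<5::int} = {0, 1, 2, 3, 4}"
  by auto

lemma card_uverts_groetzsch_graph: "card (uverts groetzsch_graph) = 11"
  unfolding groetzsch_graph_def residues_mod_5 by simp

lemma card_uedges_groetzsch_graph: "card (uedges groetzsch_graph) = 20"
proof -
  let ?I = "{0..<5::int}"
  let ?A = "(\<lambda>i. {U i, U ((i + 1) mod 5)}) ` ?I"
  let ?B = "(\<lambda>i. {V i, U ((i - 1) mod 5)}) ` ?I"
  let ?C = "(\<lambda>i. {V i, U ((i + 1) mod 5)}) ` ?I"
  let ?D = "(\<lambda>i. {W, V i}) ` ?I"
  have no_2_cycle: "i \<noteq> ((i + 1) mod 5 + 1) mod 5" for i :: int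
    by presburger
  have "inj_on (\<lambda>i. {U i, U ((i + 1) mod 5)}) ?I"
    using no_2_cycle by (auto simp: inj_on_def doubleton_eq_iff)
  then have A: "card ?A = 5"
    by (simp add: card_image)
  have B: "card ?B = 5" and C: "card ?C = 5" and D: "card ?D = 5"
    by (simp_all add: card_image inj_on_def doubleton_eq_iff)
  have "(i - 1) mod 5 \<noteq> (i + 1) mod 5" for i :: int
    by presburger
  then have "?B \<inter> ?C = {}"
    by (auto simp: doubleton_eq_iff)
  then have BC: "card (?B \<union> ?C) = 10"
    using B C by (simp add: card_Un_disjoint)
  have "?A \<inter> (?B \<union> ?C) = {}"
    by (auto simp: doubleton_eq_iff)
  then have ABC: "card (?A \<union> (?B \<union> ?C)) = 15"
    using A BC by (simp add: card_Un_disjoint)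
  have "(?A \<union> (?B \<union> ?C)) \<inter> ?D = {}"
    by (auto simp: doubleton_eq_iff)
  then have "card (?A \<union> (?B \<union> ?C) \<union> ?D) = 20"
    using ABC D by (simp add: card_Un_disjoint)
  then show ?thesis
    unfolding groetzsch_graph_def ugraph.simps Setcompr_eq_image Un_assoc .
qed

lemma groetzsch_graph_edges:
  assumes "i < (5::nat)"
  shows "{U (int i), U (int ((i + 1) mod 5))} \<in> uedges groetzsch_graph"
    and "{V (int i), U (int ((i + 1) mod 5))} \<in> uedges groetzsch_graph"
    and "{V (int ((i + 1) mod 5)), U (int i)} \<in> uedges groetzsch_graph"
    and "{W, V (int i)} \<in> uedges groetzsch_graph"
proof -
  have succ: "int ((i + 1) mod 5) = (int i + 1) mod 5"
    by (simp add: zmod_int add.commute)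
  have pred: "((int i + 1) mod 5 - 1) mod 5 = int i"
    using assms by presburger
  have i: "int i \<in> {0..<5}"
    using assms by simp
  have si: "(int i + 1) mod 5 \<in> {0..<5}"
    by simp
  show "{U (int i), U (int ((i + 1) mod 5))} \<in> uedges groetzsch_graph"
    and "{V (int i), U (int ((i + 1) mod 5))} \<in> uedges groetzsch_graph"
    and "{W, V (int i)} \<in> uedges groetzsch_graph"
    unfolding groetzsch_graph_def succ ugraph.simps using i by blast+
  have "{V ((int i + 1) mod 5), U (((int i + 1) mod 5 - 1) mod 5)} \<in> uedges groetzsch_graph"
    unfolding groetzsch_graph_def ugraph.simps using si by blast
  then show "{V (int ((i + 1) mod 5)), U (int i)} \<in> uedges groetzsch_graph"
    by (simp only: succ pred)
qed

text \<open>Mycielski's construction adds exactly one colour: the twins \<open>V i\<close> repeat a 3-colouring of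
  the 5-cycle and \<open>W\<close> takes the fourth colour, whereas a 3-colouring would yield a 2-colouring
  of the 5-cycle.\<close>

lemma chromatic_number_groetzsch_graph: "chromatic_number groetzsch_graph = 4"
proof (rule chromatic_number_eqI)
  let ?h = "\<lambda>i::int. if i = 4 then 2 else nat (i mod 2)"
  let ?c = "\<lambda>x. case x of U i \<Rightarrow> ?h i | V i \<Rightarrow> ?h i | W \<Rightarrow> 3"
  show "proper_colouring groetzsch_graph 4 ?c"
  proof (rule proper_colouringI[OF simple_graph_groetzsch_graph])
    show "?c x < 4" if "x \<in> uverts groetzsch_graph" for x
      using that unfolding groetzsch_graph_def residues_mod_5 ugraph.simps by auto
    have "\<forall>e\<in>uedges groetzsch_graph. inj_on ?c e"
      unfolding groetzsch_graph_def residues_mod_5 Setcompr_eq_image ugraph.simps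
        image_insert image_empty ball_Un
      by simp
    then show "inj_on ?c e" if "e \<in> uedges groetzsch_graph" for e
      using that by blast
  qed
next
  fix j d
  assume d: "proper_colouring groetzsch_graph j d"
  show "4 \<le> j"
  proof (rule ccontr)
    assume "\<not> 4 \<le> j"
    then have colours: "d x \<in> {0, 1, 2}" if "x \<in> uverts groetzsch_graph" for x
      using d that by (force simp: proper_colouring_def)
    have differ: "d x \<noteq> d y" if "{x, y} \<in> uedges groetzsch_graph" for x y
      using d that by (auto simp: proper_colouring_def)
    have verts: "W \<in> uverts groetzsch_graph"
      "\<And>i. i < 5 \<Longrightarrow> U (int i) \<in> uverts groetzsch_graph"
      "\<And>i. i < 5 \<Longrightarrow> V (int i) \<in> uverts groetzsch_graph"
      by (auto simp: groetzsch_graph_def)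
    define f where "f i = (if d (U (int i)) = d W then d (V (int i)) else d (U (int i)))" for i
    obtain p q where pq: "{0, 1, 2} - {d W} \<subseteq> {p, q}"
      using colours[OF verts(1)] by fastforce
    have two: "f i \<in> {p, q}" if "i < 5" for i
    proof -
      have "f i \<in> {0, 1, 2} - {d W}"
        using colours[OF verts(2)[OF that]] colours[OF verts(3)[OF that]]
          differ[OF groetzsch_graph_edges(4)[OF that]]
        by (auto simp: f_def)
      then show ?thesis
        using pq by blast
    qed
    have "f i \<noteq> f ((i + 1) mod 5)" if "i < 5" for i
      using differ[OF groetzsch_graph_edges(1)[OF that]]
        differ[OF groetzsch_graph_edges(2)[OF that]]
        differ[OF groetzsch_graph_edges(3)[OF that]]
      by (auto simp: f_def)
    then show False
      using no_alternation_on_odd_cycle[of 5 f p q] two by simp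
  qed
qed

section \<open>The equalities\<close>

theorem mainTheorem5:
  shows
    "(card (uverts (cycle_graph 5)) = 5 \<and> card (uedges (cycle_graph 5)) = 5 \<and>
      int (chromatic_number (cycle_graph 5)) =
        \<lceil>real (card (uedges (cycle_graph 5))) /
          (2 * sqrt (real (card (uverts (cycle_graph 5)))))\<rceil> + 1)
     \<and>
     (card (uverts groetzsch_graph) = 11 \<and> card (uedges groetzsch_graph) = 20 \<and>
      chromatic_number groetzsch_graph = 4 \<and>
      (4::int) = \<lceil>(20::real) / sqrt 60.5\<rceil> + 1 \<and>
      int (chromatic_number groetzsch_graph) =
        \<lceil>real (card (uedges groetzsch_graph)) /
          sqrt (5.5 * real (card (uverts groetzsch_graph)))\<rceil> + 1)
     \<and>
     (\<forall>l::nat. odd l \<and> 7 \<le> l \<and> l \<le> 21 \<longrightarrow>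
        card (uverts (cycle_graph l)) = l \<and> card (uedges (cycle_graph l)) = l \<and>
        int (chromatic_number (cycle_graph l)) =
          \<lceil>real (card (uedges (cycle_graph l))) /
            sqrt (5.5 * real (card (uverts (cycle_graph l))))\<rceil> + 1)"
proof (intro conjI allI impI)
  show "card (uverts (cycle_graph 5)) = 5" "card (uedges (cycle_graph 5)) = 5"
    by (simp_all add: card_uverts_cycle_graph card_uedges_cycle_graph)
  have "2 * sqrt 5 = sqrt 20"
    using real_sqrt_mult[of 4 5] by simp
  then show "int (chromatic_number (cycle_graph 5)) =
      \<lceil>real (card (uedges (cycle_graph 5))) /
        (2 * sqrt (real (card (uverts (cycle_graph 5)))))\<rceil> + 1"
    using ceiling_divide_sqrt[of 5 20 1]
    by (simp add: card_uverts_cycle_graph card_uedges_cycle_graph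
        chromatic_number_odd_cycle_graph)
next
  show "card (uverts groetzsch_graph) = 11" "card (uedges groetzsch_graph) = 20"
    "chromatic_number groetzsch_graph = 4"
    by (simp_all add: card_uverts_groetzsch_graph card_uedges_groetzsch_graph
        chromatic_number_groetzsch_graph)
  show bound: "(4::int) = \<lceil>(20::real) / sqrt 60.5\<rceil> + 1"
    using ceiling_divide_sqrt[of 20 "60.5" 2] by (simp add: power2_eq_square)
  have "5.5 * real 11 = 60.5"
    by simp
  then show "int (chromatic_number groetzsch_graph) =
      \<lceil>real (card (uedges groetzsch_graph)) /
        sqrt (5.5 * real (card (uverts groetzsch_graph)))\<rceil> + 1"
    unfolding card_uverts_groetzsch_graph card_uedges_groetzsch_graph
      chromatic_number_groetzsch_graph
    using bound by (simp only: of_nat_numeral)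
next
  fix l :: nat
  assume l: "odd l \<and> 7 \<le> l \<and> l \<le> 21"
  then show "card (uverts (cycle_graph l)) = l" "card (uedges (cycle_graph l)) = l"
    by (simp_all add: card_uverts_cycle_graph card_uedges_cycle_graph)
  (* l / sqrt (5.5 l) lies in (1, 2] exactly when 5.5 < l and l is at most 22. *)
  have "\<lceil>real l / sqrt (5.5 * real l)\<rceil> = int 1 + 1"
    by (rule ceiling_divide_sqrt) (use l in \<open>simp_all add: power2_eq_square\<close>)
  then show "int (chromatic_number (cycle_graph l)) =
      \<lceil>real (card (uedges (cycle_graph l))) /
        sqrt (5.5 * real (card (uverts (cycle_graph l))))\<rceil> + 1"
    using l by (simp add: card_uverts_cycle_graph card_uedges_cycle_graph
        chromatic_number_odd_cycle_graph)
qed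

end
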